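(* Let $\beta\in\mathbb R^\sigma$. The following conclusions hold. (a) The limit $\varphi(\beta):=-\lim_{n\to\infty}\frac1{a_n}\log Z_n(a_n\beta)$ exists and is given by $$\varphi(\beta)=\inf_{x\in\mathcal X}\{\langle\beta,\tilde H(x)\rangle+I(x)\};$$ $\varphi(\beta)$ is a finite, concave, continuous function on $\mathbb R^\sigma$. (b) With respect to $P_{n,a_n\beta}$, $Y_n$ satisfies the large deviation principle on $\mathcal X$ with scaling constants $a_n$ and rate function $$I_\beta(x):=I(x)+\langle\beta,\tilde H(x)\rangle-\inf_{y\in\mathcal X}\{I(y)+\langle\beta,\tilde H(y)\rangle\}=I(x)+\langle\beta,\tilde H(x)\rangle-\varphi(\beta).$$ (c) The set $\mathcal E_\beta:=\{x\in\mathcal X: I_\beta(x)=0\}$ is a nonempty, compact subset of $\mathcal X$. A point $\bar x$ lies in $\mathcal E_\beta$ if and only if $$I(\bar x)+\langle\beta,\tilde H(\bar x)\rangle=\inf_{y\in\mathcal X}\{I(y)+\langle\beta,\tilde H(y)\rangle\}=\varphi(\beta);$$ equivalently, if and only if $\bar x$ solves the following unconstrained minimization problem: minimize $I(x)+\langle\beta,\tilde H(x)\rangle$ over $x\in\mathcal X$. (d) If $A$ is any Borel subset of $\mathcal X$ whose closure $\bar A$ satisfies $\bar A\cap\mathcal E_\beta=\emptyset$, then $I_\beta(\bar A)>0$ and for some $C<\infty$ $$P_{n,a_n\beta}\{Y_n\in A\}\le C\exp[-a_nI_\beta(\bar A)/2]\to0\quad\text{as } n\to\infty.$$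
   Context: Setting. For each $n\in\mathbb N$, $(\Omega_n,\mathcal F_n,P_n)$ is a probability space; $\sigma\ge1$ is an integer; $H_{n,1},\dots,H_{n,\sigma}:\Omega_n\to\mathbb R$ are bounded measurable functions and $H_n:=(H_{n,1},\dots,H_{n,\sigma})$; $a_n>0$ are scaling constants with $a_n\to\infty$. $\mathcal X$ is a Polish space (complete separable metric space), $Y_n:\Omega_n\to\mathcal X$ are random variables, and $\tilde H_1,\dots,\tilde H_\sigma:\mathcal X\to\mathbb R$ are bounded continuous functions such that $\lim_{n\to\infty}\sup_{\omega\in\Omega_n}|H_{n,i}(\omega)-\tilde H_i(Y_n(\omega))|=0$ for each $i$; $\tilde H:=(\tilde H_1,\dots,\tilde H_\sigma)$. $\langle\cdot,\cdot\rangle$ is the Euclidean inner product on $\mathbb R^\sigma$. A rate function on $\mathcal X$ is a function $K:\mathcal X\to[0,\infty]$ whose level sets $\{x: K(x)\le M\}$, $0\le M<\infty$, are compact; for $A\subset\mathcal X$, $K(A):=\inf_{x\in A}K(x)$ (with $\inf\emptyset=\infty$). Given probability measures $Q_n$ on $(\Omega_n,\mathcal F_n)$, $Y_n$ satisfies the large deviation principle (LDP) on $\mathcal X$ with respect to $Q_n$, with scaling constants $a_n$ and rate function $K$, if $\limsup_{n\to\infty}\frac1{a_n}\log Q_n\{Y_n\in F\}\le-K(F)$ for every closed $F\subset\mathcal X$ and $\liminf_{n\to\infty}\frac1{a_n}\log Q_n\{Y_n\in G\}\ge-K(G)$ for every open $G\subset\mathcal X$. It is assumed that with respect to $P_n$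 the sequence $Y_n$ satisfies the LDP on $\mathcal X$ with scaling constants $a_n$ and some rate function $I$. For $\beta\in\mathbb R^\sigma$: $Z_n(\beta):=\int_{\Omega_n}\exp[-\langle\beta,H_n\rangle]\,dP_n$ and $P_{n,\beta}\{B\}:=\frac1{Z_n(\beta)}\int_B\exp[-\langle\beta,H_n\rangle]\,dP_n$ for $B\in\mathcal F_n$ (canonical ensemble).
   Formalization: In (d), when I_β(Ā)=∞ the printed bound would force P_{n,a_nβ}{Y_n∈A}=0, which can fail; there the bound is proved with every finite r>0 in place of I_β(Ā), with C depending on r. The case I_β(Ā)<∞ is as printed. *)

theory Defs
  imports "HOL-Probability.Probability"
begin

(* Logarithm of a probability with log 0 = -\<infinity>; the library has ln 0 = 0. *)
definition ext_ln :: "real \<Rightarrow> ereal" where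
  "ext_ln p = (if p > 0 then ereal (ln p) else -\<infinity>)"

definition rate_function :: "('x::topological_space \<Rightarrow> ereal) \<Rightarrow> bool" where
  "rate_function K \<longleftrightarrow>
     (\<forall>x. 0 \<le> K x) \<and> (\<forall>M::real. 0 \<le> M \<longrightarrow> compact {x. K x \<le> ereal M})"

(* Infima are taken in ereal, so the infimum over the empty set is \<infinity>. *)
definition LDP ::
  "(nat \<Rightarrow> 'w measure) \<Rightarrow> (nat \<Rightarrow> 'w \<Rightarrow> 'x::topological_space) \<Rightarrow> (nat \<Rightarrow> real)
     \<Rightarrow> ('x \<Rightarrow> ereal) \<Rightarrow> bool" where
  "LDP Q Y a K \<longleftrightarrow>
     (\<forall>n. prob_space (Q n)) \<and>
     rate_function K \<and>
     (\<forall>F. closed F \<longrightarrow>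
        limsup (\<lambda>n. ereal (1 / a n) * ext_ln (measure (Q n) {\<omega> \<in> space (Q n). Y n \<omega> \<in> F}))
          \<le> - (INF x\<in>F. K x)) \<and>
     (\<forall>G. open G \<longrightarrow>
        liminf (\<lambda>n. ereal (1 / a n) * ext_ln (measure (Q n) {\<omega> \<in> space (Q n). Y n \<omega> \<in> G}))
          \<ge> - (INF x\<in>G. K x))"

definition partition_fun ::
  "(nat \<Rightarrow> 'w measure) \<Rightarrow> (nat \<Rightarrow> 'w \<Rightarrow> real ^ 's) \<Rightarrow> nat \<Rightarrow> real ^ 's \<Rightarrow> real" where
  "partition_fun P H n \<beta> = (\<integral>\<omega>. exp (- (\<beta> \<bullet> H n \<omega>)) \<partial>P n)"

definition canonical ::
  "(nat \<Rightarrow> 'w measure) \<Rightarrow> (nat \<Rightarrow> 'w \<Rightarrow> real ^ 's) \<Rightarrow> nat \<Rightarrow> real ^ 's \<Rightarrow> 'w measure" where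
  "canonical P H n \<beta> =
     density (P n) (\<lambda>\<omega>. ennreal (1 / partition_fun P H n \<beta> * exp (- (\<beta> \<bullet> H n \<omega>))))"

(* \<phi>. The operator lim is only meaningful for a convergent sequence. *)
definition free_energy ::
  "(nat \<Rightarrow> real) \<Rightarrow> (nat \<Rightarrow> 'w measure) \<Rightarrow> (nat \<Rightarrow> 'w \<Rightarrow> real ^ 's) \<Rightarrow> real ^ 's \<Rightarrow> real" where
  "free_energy a P H \<beta> = - lim (\<lambda>n. 1 / a n * ln (partition_fun P H n (a n *\<^sub>R \<beta>)))"

definition canonical_rate ::
  "('x \<Rightarrow> ereal) \<Rightarrow> ('x \<Rightarrow> real ^ 's) \<Rightarrow> real ^ 's \<Rightarrow> 'x \<Rightarrow> ereal" where
  "canonical_rate I Ht \<beta> x =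
     I x + ereal (\<beta> \<bullet> Ht x) - (INF y. I y + ereal (\<beta> \<bullet> Ht y))"

definition equilibrium_set ::
  "('x \<Rightarrow> ereal) \<Rightarrow> ('x \<Rightarrow> real ^ 's) \<Rightarrow> real ^ 's \<Rightarrow> 'x set" where
  "equilibrium_set I Ht \<beta> = {x. canonical_rate I Ht \<beta> x = 0}"

end

theory Submission
  imports Defs
begin

text \<open>
Write \<open>g x = \<beta> \<bullet> Ht x\<close>. The theorem is Laplace's principle: under \<open>P n\<close> the event that \<open>Y n\<close> is near \<open>x\<close>
has probability about \<open>exp (- a n * I x)\<close>, and there the Boltzmann factor is about \<open>exp (- a n * g x)\<close>,
because \<open>H n\<close> is uniformly close to \<open>Ht (Y n)\<close>. Hence the unnormalised mass of \<open>{Y n \<in> A}\<close> is about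
\<open>exp (- a n * inf (I + g))\<close> with the infimum over \<open>A\<close>. Taking for \<open>A\<close> the whole space gives the limit of
the free energy, and dividing by this total mass gives the large deviation principle for the
canonical ensemble, with \<open>I + g\<close> normalised to have infimum \<open>0\<close>.

The large deviation principle is used throughout in an equivalent form free of logarithms and of
extended-real limits: for \<open>r < inf K\<close> over a closed set the probability is eventually at most
\<open>exp (- a n * r)\<close>, and for \<open>r > K x\<close> with \<open>x\<close> in an open set it is eventually at least
\<open>exp (- a n * r)\<close> (\<open>LDP_upper\<close>, \<open>LDP_lower\<close>, \<open>LDP_I\<close>). The lower bound for the tilted mass,
\<open>weight_lower\<close>, needs one small neighbourhood of a nearly optimal point. The upper bound,
\<open>weight_upper\<close>, cuts the range of \<open>g\<close>, which is bounded, into finitely many thin slices and adds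
the bounds for the slices.

The remaining claims are soft. The free energy is an infimum of affine functions of \<open>\<beta>\<close>, hence concave,
and a finite concave function on a Euclidean space is continuous. Compact sublevel sets force a rate
function to attain a finite infimum on every closed set (\<open>rate_function_attains_INF\<close>): on the whole space
this gives equilibrium points, and on the closure of \<open>A\<close> it shows that the infimum \<open>J\<close> is positive if
there are none. Exponents strictly below \<open>J\<close>, such as \<open>J / 2\<close>, then bound the probabilities.
\<close>

section \<open>Exponential bounds equivalent to a large deviation principle\<close>

lemma scaled_ext_ln_le_iff:
  assumes "0 < a"
  shows "ereal (1 / a) * ext_ln m \<le> ereal (- r) \<longleftrightarrow> m \<le> exp (- (a * r))"
proof (cases "0 < m")
  case True
  have "1 / a * ln m \<le> - r \<longleftrightarrow> ln m \<le> - (a * r)"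
    using assms by (simp add: field_simps)
  also have "\<dots> \<longleftrightarrow> m \<le> exp (- (a * r))"
    using True by (metis ln_exp exp_gt_zero ln_le_cancel_iff)
  finally show ?thesis using True by (simp add: ext_ln_def)
next
  case False
  then have "m \<le> exp (- (a * r))" by (meson exp_gt_zero less_le_trans not_le order.strict_implies_order)
  then show ?thesis using False assms by (simp add: ext_ln_def)
qed

lemma scaled_ext_ln_ge_iff:
  assumes "0 < a"
  shows "ereal (- r) \<le> ereal (1 / a) * ext_ln m \<longleftrightarrow> exp (- (a * r)) \<le> m"
proof (cases "0 < m")
  case True
  have "- r \<le> 1 / a * ln m \<longleftrightarrow> - (a * r) \<le> ln m"
    using assms by (simp add: field_simps)
  also have "\<dots> \<longleftrightarrow> exp (- (a * r)) \<le> m"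
    using True by (metis ln_exp exp_gt_zero ln_le_cancel_iff)
  finally show ?thesis using True by (simp add: ext_ln_def)
next
  case False
  then have "\<not> exp (- (a * r)) \<le> m" by (meson exp_gt_zero less_le_trans)
  then show ?thesis using False assms by (simp add: ext_ln_def)
qed

text \<open>A real number \<open>c\<close> below \<open>K\<close> on \<open>F\<close> stands in for the extended real \<open>INF x\<in>F. K x\<close>, which may be
  \<open>\<infinity>\<close>; the gap between \<open>r\<close> and \<open>c\<close> absorbs the subexponential factors that a limit superior ignores.\<close>
lemma LDP_upper:
  assumes L: "LDP Q Y a K" and a: "\<And>n. 0 < a n" and F: "closed F"
    and c: "\<And>x. x \<in> F \<Longrightarrow> ereal c \<le> K x" and r: "r < c"
  shows "\<forall>\<^sub>F n in sequentially. measure (Q n) {\<omega> \<in> space (Q n). Y n \<omega> \<in> F} \<le> exp (- (a n * r))"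
proof -
  have "limsup (\<lambda>n. ereal (1 / a n) * ext_ln (measure (Q n) {\<omega> \<in> space (Q n). Y n \<omega> \<in> F}))
      \<le> - (INF x\<in>F. K x)"
    using L F by (simp add: LDP_def)
  moreover have "ereal c \<le> (INF x\<in>F. K x)" using c by (intro INF_greatest)
  then have "- (INF x\<in>F. K x) < ereal (- r)"
    using r by (metis ereal_minus_less_minus less_ereal.simps(1) less_le_trans uminus_ereal.simps(1))
  ultimately have "\<forall>\<^sub>F n in sequentially.
      ereal (1 / a n) * ext_ln (measure (Q n) {\<omega> \<in> space (Q n). Y n \<omega> \<in> F}) < ereal (- r)"
    unfolding Limsup_le_iff by blast
  then show ?thesis
    by eventually_elim (use a in \<open>simp flip: scaled_ext_ln_le_iff\<close>)
qed

lemma LDP_lower: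
  assumes L: "LDP Q Y a K" and a: "\<And>n. 0 < a n" and G: "open G"
    and x: "x \<in> G" and r: "K x < ereal r"
  shows "\<forall>\<^sub>F n in sequentially. exp (- (a n * r)) \<le> measure (Q n) {\<omega> \<in> space (Q n). Y n \<omega> \<in> G}"
proof -
  have "- (INF x\<in>G. K x)
      \<le> liminf (\<lambda>n. ereal (1 / a n) * ext_ln (measure (Q n) {\<omega> \<in> space (Q n). Y n \<omega> \<in> G}))"
    using L G by (simp add: LDP_def)
  moreover have "(INF x\<in>G. K x) < ereal r" using x r by (meson INF_lower le_less_trans)
  then have "ereal (- r) < - (INF x\<in>G. K x)"
    by (metis ereal_minus_less_minus uminus_ereal.simps(1))
  ultimately have "\<forall>\<^sub>F n in sequentially.
      ereal (- r) < ereal (1 / a n) * ext_ln (measure (Q n) {\<omega> \<in> space (Q n). Y n \<omega> \<in> G})"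
    unfolding le_Liminf_iff by blast
  then show ?thesis
    by eventually_elim (use a in \<open>simp flip: scaled_ext_ln_ge_iff\<close>)
qed

lemma LDP_I:
  assumes a: "\<And>n. 0 < a n" and "\<And>n. prob_space (Q n)" and "rate_function K"
    and upper: "\<And>F c r. closed F \<Longrightarrow> (\<And>x. x \<in> F \<Longrightarrow> ereal c \<le> K x) \<Longrightarrow> r < c \<Longrightarrow>
      \<forall>\<^sub>F n in sequentially. measure (Q n) {\<omega> \<in> space (Q n). Y n \<omega> \<in> F} \<le> exp (- (a n * r))"
    and lower: "\<And>G x r. open G \<Longrightarrow> x \<in> G \<Longrightarrow> K x < ereal r \<Longrightarrow>
      \<forall>\<^sub>F n in sequentially. exp (- (a n * r)) \<le> measure (Q n) {\<omega> \<in> space (Q n). Y n \<omega> \<in> G}"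
  shows "LDP Q Y a K"
  unfolding LDP_def
proof (intro conjI allI impI)
  fix F :: "'b set" assume F: "closed F"
  show "limsup (\<lambda>n. ereal (1 / a n) * ext_ln (measure (Q n) {\<omega> \<in> space (Q n). Y n \<omega> \<in> F}))
      \<le> - (INF x\<in>F. K x)"
    unfolding Limsup_le_iff
  proof (intro allI impI)
    fix y assume "- (INF x\<in>F. K x) < y"
    then have "- y < (INF x\<in>F. K x)" by (metis ereal_minus_less_minus ereal_uminus_uminus)
    then obtain r where r: "- y < ereal r" "ereal r < (INF x\<in>F. K x)" using ereal_dense2 by blast
    then obtain c where c: "ereal r < ereal c" "ereal c < (INF x\<in>F. K x)" using ereal_dense2 by blast
    have "ereal c \<le> K x" if "x \<in> F" for x using c(2) that by (meson INF_lower less_imp_le less_le_trans)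
    then have "\<forall>\<^sub>F n in sequentially. measure (Q n) {\<omega> \<in> space (Q n). Y n \<omega> \<in> F} \<le> exp (- (a n * r))"
      using upper[OF F, of c r] c(1) by simp
    moreover have "ereal (- r) < y"
      using r(1) by (metis ereal_minus_less_minus ereal_uminus_uminus uminus_ereal.simps(1))
    ultimately show "\<forall>\<^sub>F n in sequentially.
        ereal (1 / a n) * ext_ln (measure (Q n) {\<omega> \<in> space (Q n). Y n \<omega> \<in> F}) < y"
      by (auto elim!: eventually_mono simp flip: scaled_ext_ln_le_iff[OF a])
  qed
next
  fix G :: "'b set" assume G: "open G"
  show "- (INF x\<in>G. K x)
      \<le> liminf (\<lambda>n. ereal (1 / a n) * ext_ln (measure (Q n) {\<omega> \<in> space (Q n). Y n \<omega> \<in> G}))"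
    unfolding le_Liminf_iff
  proof (intro allI impI)
    fix y assume "y < - (INF x\<in>G. K x)"
    then have "(INF x\<in>G. K x) < - y" by (metis ereal_minus_less_minus ereal_uminus_uminus)
    then obtain r where r: "(INF x\<in>G. K x) < ereal r" "ereal r < - y" using ereal_dense2 by blast
    then obtain x where "x \<in> G" "K x < ereal r" by (auto simp: INF_less_iff)
    then have "\<forall>\<^sub>F n in sequentially. exp (- (a n * r)) \<le> measure (Q n) {\<omega> \<in> space (Q n). Y n \<omega> \<in> G}"
      using lower[OF G] by blast
    moreover have "y < ereal (- r)"
      using r(2) by (metis ereal_minus_less_minus ereal_uminus_uminus uminus_ereal.simps(1))
    ultimately show "\<forall>\<^sub>F n in sequentially.
        y < ereal (1 / a n) * ext_ln (measure (Q n) {\<omega> \<in> space (Q n). Y n \<omega> \<in> G})"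
      by (auto elim!: eventually_mono simp flip: scaled_ext_ln_ge_iff[OF a])
  qed
qed (use assms in auto)

section \<open>Rate functions\<close>

lemma rate_function_closed_sublevel:
  fixes K :: "'x::t2_space \<Rightarrow> ereal"
  assumes "rate_function K"
  shows "closed {x. K x \<le> ereal M}"
proof (cases "0 \<le> M")
  case True
  then show ?thesis using assms by (simp add: rate_function_def compact_imp_closed)
next
  case False
  have "\<not> K x \<le> ereal M" for x
  proof
    assume "K x \<le> ereal M"
    moreover have "0 \<le> K x" using assms by (simp add: rate_function_def)
    ultimately have "ereal 0 \<le> ereal M" by (metis order_trans zero_ereal_def)
    then show False using False by simp
  qed
  then have "{x. K x \<le> ereal M} = {}" by blast
  then show ?thesis by simp
qed

text \<open>For a finite infimum \<open>m\<close> the sets \<open>F \<inter> {x. K x \<le> m + 1 / (n + 1)}\<close> are nonempty, compact and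
  decreasing in \<open>n\<close>, so they have a common point.\<close>
lemma rate_function_attains_INF:
  fixes K :: "'x::t2_space \<Rightarrow> ereal"
  assumes K: "rate_function K" and F: "closed F" and m: "(INF x\<in>F. K x) = ereal m"
  shows "\<exists>x\<in>F. K x = ereal m"
proof -
  have "0 \<le> (INF x\<in>F. K x)" using K by (auto simp: rate_function_def intro: INF_greatest)
  then have "0 \<le> m" by (simp add: m)
  define S where "S n = {x. K x \<le> ereal (m + 1 / real (Suc n))}" for n
  have "compact (F \<inter> S 0)"
    unfolding S_def using K \<open>0 \<le> m\<close> F by (intro closed_Int_compact) (simp_all add: rate_function_def)
  moreover have "closed (S n)" for n
    unfolding S_def by (rule rate_function_closed_sublevel[OF K])
  moreover have "(F \<inter> S 0) \<inter> (\<Inter>n\<in>N. S n) \<noteq> {}" if "finite N" for N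
  proof -
    obtain k where k: "\<And>n. n \<in> N \<Longrightarrow> n \<le> k"
      using \<open>finite N\<close> by (meson finite_nat_set_iff_bounded_le)
    have "(INF x\<in>F. K x) < ereal (m + 1 / real (Suc k))" by (simp add: m)
    then obtain x where x: "x \<in> F" "K x < ereal (m + 1 / real (Suc k))" by (auto simp: INF_less_iff)
    have "x \<in> S n" if "n \<le> k" for n
    proof -
      have "1 / real (Suc k) \<le> 1 / real (Suc n)" using that by (simp add: frac_le)
      then have "ereal (m + 1 / real (Suc k)) \<le> ereal (m + 1 / real (Suc n))" by simp
      then show ?thesis unfolding S_def using x(2) by (meson less_imp_le mem_Collect_eq order_trans)
    qed
    then show ?thesis using x(1) k by blast
  qed
  ultimately have "(F \<inter> S 0) \<inter> (\<Inter>n\<in>UNIV. S n) \<noteq> {}"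
    by (rule compact_imp_fip_image)
  then obtain x where x: "x \<in> F" "\<And>n. x \<in> S n" by blast
  have "K x \<le> ereal m"
  proof (rule ereal_le_epsilon2)
    fix e :: real assume "0 < e"
    then obtain n where "1 / real (Suc n) < e" by (metis inverse_eq_divide reals_Archimedean)
    then have "ereal (m + 1 / real (Suc n)) \<le> ereal m + ereal e" by simp
    then show "K x \<le> ereal m + ereal e" using x(2)[of n] unfolding S_def by (meson mem_Collect_eq order_trans)
  qed
  moreover have "ereal m \<le> K x" using x(1) m by (metis INF_lower)
  ultimately show ?thesis using x(1) by (auto intro: antisym)
qed

lemma ereal_add_minus_le_iff:
  "(i::ereal) + ereal g - ereal c \<le> ereal M \<longleftrightarrow> i \<le> ereal (M + c - g)"
  by (cases i) (auto simp: algebra_simps)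

text \<open>The sublevel set \<open>{x. I x \<le> L - g x}\<close> is closed because it is the intersection over real \<open>t\<close> of
  the closed sets \<open>{x. I x \<le> L - t \<or> g x \<le> t}\<close>, and it lies in a compact sublevel set of \<open>I\<close> because
  \<open>g\<close> is bounded below.\<close>
lemma rate_function_tilt:
  fixes I :: "'x::t2_space \<Rightarrow> ereal"
  assumes I: "rate_function I" and g: "continuous_on UNIV g" and B: "\<And>x. - B \<le> g x"
    and nonneg: "\<And>x. 0 \<le> I x + ereal (g x) - ereal c"
  shows "rate_function (\<lambda>x. I x + ereal (g x) - ereal c)"
  unfolding rate_function_def
proof (intro conjI allI impI)
  fix M :: real
  define L where "L = M + c"
  have "{x. I x \<le> ereal (L - g x)} = (\<Inter>t. {x. I x \<le> ereal (L - t)} \<union> {x. g x \<le> t})"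
  proof (intro equalityI subsetI)
    fix x assume x: "x \<in> {x. I x \<le> ereal (L - g x)}"
    have "I x \<le> ereal (L - t)" if "\<not> g x \<le> t" for t
    proof -
      have "ereal (L - g x) \<le> ereal (L - t)" using that by simp
      then show ?thesis using x order_trans by blast
    qed
    then show "x \<in> (\<Inter>t. {x. I x \<le> ereal (L - t)} \<union> {x. g x \<le> t})" by blast
  next
    fix x assume x: "x \<in> (\<Inter>t. {x. I x \<le> ereal (L - t)} \<union> {x. g x \<le> t})"
    have "I x \<le> ereal (L - g x)"
    proof (rule ereal_le_epsilon2)
      fix e :: real assume "0 < e"
      moreover have "I x \<le> ereal (L - (g x - e)) \<or> g x \<le> g x - e" using x by blast
      ultimately show "I x \<le> ereal (L - g x) + ereal e" by (simp add: algebra_simps)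
    qed
    then show "x \<in> {x. I x \<le> ereal (L - g x)}" by simp
  qed
  moreover have "closed {x. g x \<le> t}" for t
    by (rule closed_Collect_le) (use g in auto)
  ultimately have "closed {x. I x \<le> ereal (L - g x)}"
    by (auto intro!: closed_INT closed_Un rate_function_closed_sublevel[OF I])
  moreover have "compact {x. I x \<le> ereal (max 0 (L + B))}"
    using I by (simp add: rate_function_def del: ereal_max)
  moreover have "{x. I x \<le> ereal (L - g x)} \<subseteq> {x. I x \<le> ereal (max 0 (L + B))}"
  proof safe
    fix x assume "I x \<le> ereal (L - g x)"
    moreover have "ereal (L - g x) \<le> ereal (max 0 (L + B))"
      unfolding ereal_less_eq using B[of x] by linarith
    ultimately show "I x \<le> ereal (max 0 (L + B))" by (rule order_trans)
  qed
  ultimately have "compact {x. I x \<le> ereal (L - g x)}"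
    by (metis closed_Int_compact inf.absorb_iff1)
  then show "compact {x. I x + ereal (g x) - ereal c \<le> ereal M}"
    unfolding ereal_add_minus_le_iff L_def .
qed (rule nonneg)

section \<open>Large deviations under exponential tilting\<close>

text \<open>For a fixed \<open>\<beta>\<close> only the scalars \<open>f n \<omega> = \<beta> \<bullet> H n \<omega>\<close> and \<open>g x = \<beta> \<bullet> Ht x\<close> enter the large
  deviation bounds; the vector structure returns when \<open>\<beta>\<close> varies.\<close>
locale exponential_tilt =
  fixes P :: "nat \<Rightarrow> 'w measure" and f :: "nat \<Rightarrow> 'w \<Rightarrow> real" and a :: "nat \<Rightarrow> real"
    and Y :: "nat \<Rightarrow> 'w \<Rightarrow> 'x::polish_space" and g :: "'x \<Rightarrow> real" and I :: "'x \<Rightarrow> ereal"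
  assumes P_prob: "\<And>n. prob_space (P n)"
    and f_meas [measurable]: "\<And>n. f n \<in> borel_measurable (P n)"
    and f_bdd: "\<And>n. bounded (f n ` space (P n))"
    and a_pos: "\<And>n. 0 < a n"
    and a_lim: "filterlim a at_top sequentially"
    and Y_meas [measurable]: "\<And>n. Y n \<in> borel_measurable (P n)"
    and g_cont: "continuous_on UNIV g"
    and g_bdd: "bounded (range g)"
    and f_approx: "\<And>d. 0 < d \<Longrightarrow> \<forall>\<^sub>F n in sequentially. \<forall>\<omega>\<in>space (P n). \<bar>f n \<omega> - g (Y n \<omega>)\<bar> \<le> d"
    and P_LDP: "LDP P Y a I"
begin

definition weight :: "nat \<Rightarrow> 'x set \<Rightarrow> real" where
  "weight n A = (\<integral>\<omega>. indicator A (Y n \<omega>) * exp (- (a n * f n \<omega>)) \<partial>P n)"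

definition tilted :: "nat \<Rightarrow> 'w measure" where
  "tilted n = density (P n) (\<lambda>\<omega>. ennreal (1 / weight n UNIV * exp (- (a n * f n \<omega>))))"

definition min_energy :: real where
  "min_energy = real_of_ereal (INF x. I x + ereal (g x))"

lemma I_rate: "rate_function I"
  using P_LDP by (simp add: LDP_def)

lemma I_nonneg: "0 \<le> I x"
  using I_rate by (simp add: rate_function_def)

lemma g_meas [measurable]: "g \<in> borel_measurable borel"
  by (rule borel_measurable_continuous_onI[OF g_cont])

lemma integrable_weight:
  assumes [measurable]: "A \<in> sets borel"
  shows "integrable (P n) (\<lambda>\<omega>. indicator A (Y n \<omega>) * exp (- (a n * f n \<omega>)))"
proof -
  interpret prob_space "P n" by (rule P_prob)
  obtain B where B: "\<And>\<omega>. \<omega> \<in> space (P n) \<Longrightarrow> \<bar>f n \<omega>\<bar> \<le> B"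
    using f_bdd[of n] by (auto simp: bounded_iff)
  have "norm (indicator A (Y n \<omega>) * exp (- (a n * f n \<omega>))) \<le> exp (a n * B)"
    if "\<omega> \<in> space (P n)" for \<omega>
  proof -
    have "a n * (- f n \<omega>) \<le> a n * B"
      using B[OF that] a_pos[of n] by (intro mult_left_mono) auto
    then show ?thesis by (auto simp: indicator_def)
  qed
  then show ?thesis by (intro integrable_const_bound[where B = "exp (a n * B)"]) (auto intro: AE_I2)
qed

lemma integral_indicator_Y:
  assumes [measurable]: "A \<in> sets borel"
  shows "(\<integral>\<omega>. indicator A (Y n \<omega>) \<partial>P n) = measure (P n) {\<omega> \<in> space (P n). Y n \<omega> \<in> A}"
proof -
  have "(\<integral>\<omega>. indicator A (Y n \<omega>) \<partial>P n)
      = (\<integral>\<omega>. indicator {\<omega> \<in> space (P n). Y n \<omega> \<in> A} \<omega> \<partial>P n :: real)"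
    by (rule Bochner_Integration.integral_cong) (auto simp: indicator_def)
  also have "\<dots> = measure (P n) {\<omega> \<in> space (P n). Y n \<omega> \<in> A}"
    by (subst Bochner_Integration.integral_indicator) (auto intro!: arg_cong2[where f=measure])
  finally show ?thesis .
qed

lemma integrable_indicator_Y:
  assumes [measurable]: "A \<in> sets borel"
  shows "integrable (P n) (\<lambda>\<omega>. indicator A (Y n \<omega>) :: real)"
proof -
  interpret prob_space "P n" by (rule P_prob)
  show ?thesis by (intro integrable_const_bound[where B = 1]) (auto simp: indicator_def)
qed

lemma weight_le:
  assumes A [measurable]: "A \<in> sets borel"
    and l: "\<And>\<omega>. \<omega> \<in> space (P n) \<Longrightarrow> Y n \<omega> \<in> A \<Longrightarrow> l \<le> f n \<omega>"
  shows "weight n A \<le> exp (- (a n * l)) * measure (P n) {\<omega> \<in> space (P n). Y n \<omega> \<in> A}"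
proof -
  have "weight n A \<le> (\<integral>\<omega>. exp (- (a n * l)) * indicator A (Y n \<omega>) \<partial>P n)"
    unfolding weight_def
    by (intro integral_mono integrable_weight integrable_mult_right integrable_indicator_Y A)
      (use a_pos[of n] l in \<open>auto simp: indicator_def\<close>)
  then show ?thesis by (simp add: integral_indicator_Y)
qed

lemma weight_ge:
  assumes A [measurable]: "A \<in> sets borel"
    and u: "\<And>\<omega>. \<omega> \<in> space (P n) \<Longrightarrow> Y n \<omega> \<in> A \<Longrightarrow> f n \<omega> \<le> u"
  shows "exp (- (a n * u)) * measure (P n) {\<omega> \<in> space (P n). Y n \<omega> \<in> A} \<le> weight n A"
proof -
  have "(\<integral>\<omega>. exp (- (a n * u)) * indicator A (Y n \<omega>) \<partial>P n) \<le> weight n A"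
    unfolding weight_def
    by (intro integral_mono integrable_weight integrable_mult_right integrable_indicator_Y A)
      (use a_pos[of n] u in \<open>auto simp: indicator_def\<close>)
  then show ?thesis by (simp add: integral_indicator_Y)
qed

lemma weight_mono:
  assumes "A \<in> sets borel" "B \<in> sets borel" "A \<subseteq> B"
  shows "weight n A \<le> weight n B"
  unfolding weight_def using assms
  by (intro integral_mono integrable_weight) (auto simp: indicator_def)

lemma weight_UN_le:
  assumes "finite J" and S: "\<And>k. k \<in> J \<Longrightarrow> S k \<in> sets borel" and A: "A \<in> sets borel" "A \<subseteq> (\<Union>k\<in>J. S k)"
  shows "weight n A \<le> (\<Sum>k\<in>J. weight n (S k))"
proof -
  have "weight n A \<le> (\<integral>\<omega>. (\<Sum>k\<in>J. indicator (S k) (Y n \<omega>) * exp (- (a n * f n \<omega>))) \<partial>P n)"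
    unfolding weight_def
  proof (intro integral_mono Bochner_Integration.integrable_sum integrable_weight S A(1))
    fix \<omega>
    show "indicator A (Y n \<omega>) * exp (- (a n * f n \<omega>))
        \<le> (\<Sum>k\<in>J. indicator (S k) (Y n \<omega>) * exp (- (a n * f n \<omega>)))"
    proof (cases "Y n \<omega> \<in> A")
      case True
      then obtain k where "k \<in> J" "Y n \<omega> \<in> S k" using A by blast
      then have "exp (- (a n * f n \<omega>)) = indicator (S k) (Y n \<omega>) * exp (- (a n * f n \<omega>))" by simp
      also have "\<dots> \<le> (\<Sum>k\<in>J. indicator (S k) (Y n \<omega>) * exp (- (a n * f n \<omega>)))"
        using \<open>finite J\<close> \<open>k \<in> J\<close> by (intro member_le_sum) auto
      finally show ?thesis using True by simp
    qed (auto intro!: sum_nonneg)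
  qed
  also have "\<dots> = (\<Sum>k\<in>J. weight n (S k))"
    unfolding weight_def by (intro Bochner_Integration.integral_sum integrable_weight S)
  finally show ?thesis .
qed

text \<open>Cut the bounded range of \<open>g\<close> into finitely many slices of height \<open>d\<close>. On the slice where
  \<open>g\<close> is about \<open>s\<close> the tilting factor is about \<open>exp (- (a n * s))\<close> and \<open>I \<ge> c - s\<close>, so \<open>s\<close> cancels and
  every slice contributes about \<open>exp (- (a n * c))\<close>. The number of slices does not depend on \<open>n\<close>.\<close>
lemma weight_upper:
  assumes F: "closed F" and c: "\<And>x. x \<in> F \<Longrightarrow> ereal c \<le> I x + ereal (g x)" and r: "r < c"
  shows "\<forall>\<^sub>F n in sequentially. weight n F \<le> exp (- (a n * r))"
proof -
  \<comment> \<open>One \<open>d\<close> each pays for the height of a slice, the gap in \<open>LDP_upper\<close>, the error in \<open>f_approx\<close>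
    and the number of slices.\<close>
  define d where "d = (c - r) / 4"
  have d: "0 < d" using r by (simp add: d_def)
  obtain B where B: "\<And>x. \<bar>g x\<bar> \<le> B" using g_bdd by (auto simp: bounded_iff)
  define s where "s k = - B + real k * d" for k
  define S where "S k = F \<inter> {x. s k \<le> g x \<and> g x \<le> s k + d}" for k
  define N where "N = nat \<lfloor>2 * B / d\<rfloor>"
  have S_closed: "closed (S k)" for k
  proof -
    have "S k = F \<inter> ({x. s k \<le> g x} \<inter> {x. g x \<le> s k + d})" by (auto simp: S_def)
    then show ?thesis using F g_cont by (auto intro!: closed_Int closed_Collect_le)
  qed
  have cover: "F \<subseteq> (\<Union>k\<in>{..N}. S k)"
  proof
    fix x assume "x \<in> F"
    define k where "k = nat \<lfloor>(g x + B) / d\<rfloor>"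
    have nn: "0 \<le> (g x + B) / d" using B[of x] d by simp
    have "(g x + B) / d \<le> 2 * B / d" using B[of x] d by (intro divide_right_mono) auto
    then have "k \<le> N" unfolding k_def N_def by (intro nat_mono floor_mono)
    have "real k \<le> (g x + B) / d" "(g x + B) / d \<le> real k + 1"
      unfolding k_def using nn by linarith+
    then have "x \<in> S k" using \<open>x \<in> F\<close> d by (simp add: S_def s_def field_simps)
    then show "x \<in> (\<Union>k\<in>{..N}. S k)" using \<open>k \<le> N\<close> by blast
  qed
  have "\<forall>\<^sub>F n in sequentially. measure (P n) {\<omega> \<in> space (P n). Y n \<omega> \<in> S k} \<le> exp (- (a n * (c - s k - 2 * d)))"
    for k
  proof (rule LDP_upper[OF P_LDP a_pos S_closed, of _ "c - s k - d"])
    fix x assume x: "x \<in> S k"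
    then have "ereal c \<le> I x + ereal (g x)" using c by (simp add: S_def)
    then have "ereal (c - g x) \<le> I x" by (cases "I x") auto
    moreover have "ereal (c - s k - d) \<le> ereal (c - g x)" using x by (simp add: S_def)
    ultimately show "ereal (c - s k - d) \<le> I x" by (meson order_trans)
  qed (use d in simp)
  then have "\<forall>\<^sub>F n in sequentially. \<forall>k\<in>{..N}.
      measure (P n) {\<omega> \<in> space (P n). Y n \<omega> \<in> S k} \<le> exp (- (a n * (c - s k - 2 * d)))"
    by (subst eventually_ball_finite_distrib) auto
  moreover have "\<forall>\<^sub>F n in sequentially. \<forall>\<omega>\<in>space (P n). \<bar>f n \<omega> - g (Y n \<omega>)\<bar> \<le> d"
    by (rule f_approx[OF d])
  moreover have "\<forall>\<^sub>F n in sequentially. ln (real (N + 1)) / d \<le> a n"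
    using a_lim by (simp add: filterlim_at_top)
  ultimately show ?thesis
  proof eventually_elim
    case (elim n)
    have slice: "weight n (S k) \<le> exp (- (a n * (c - 3 * d)))" if "k \<in> {..N}" for k
    proof -
      have "weight n (S k) \<le> exp (- (a n * (s k - d))) * measure (P n) {\<omega> \<in> space (P n). Y n \<omega> \<in> S k}"
        using elim(2) by (intro weight_le borel_closed S_closed) (force simp: S_def)
      also have "\<dots> \<le> exp (- (a n * (s k - d))) * exp (- (a n * (c - s k - 2 * d)))"
        using elim(1) that by (intro mult_left_mono) auto
      also have "\<dots> = exp (- (a n * (c - 3 * d)))"
        by (simp add: algebra_simps flip: exp_add)
      finally show ?thesis .
    qed
    have "weight n F \<le> (\<Sum>k\<in>{..N}. weight n (S k))"
      using cover by (intro weight_UN_le borel_closed F S_closed) auto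
    also have "\<dots> \<le> real (N + 1) * exp (- (a n * (c - 3 * d)))"
      using sum_bounded_above[of "{..N}" "\<lambda>k. weight n (S k)", OF slice] by simp
    also have "real (N + 1) \<le> exp (a n * d)"
    proof -
      have "ln (real (N + 1)) \<le> a n * d" using elim(3) d by (simp add: field_simps)
      then show ?thesis by (metis exp_le_cancel_iff exp_ln of_nat_0_less_iff zero_less_Suc Suc_eq_plus1)
    qed
    then have "real (N + 1) * exp (- (a n * (c - 3 * d))) \<le> exp (a n * d) * exp (- (a n * (c - 3 * d)))"
      by (intro mult_right_mono) auto
    also have "\<dots> = exp (- (a n * r))"
      by (simp add: d_def field_simps flip: exp_add)
    finally show ?case .
  qed
qed

text \<open>Near a single point \<open>x\<close> the function \<open>g\<close> is almost the constant \<open>g x\<close>, so the tilting factor is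
  almost constant on a neighbourhood whose probability is at least about \<open>exp (- (a n * I x))\<close>.\<close>
lemma weight_lower:
  assumes G: "open G" and x: "x \<in> G" and r: "I x + ereal (g x) < ereal r"
  shows "\<forall>\<^sub>F n in sequentially. exp (- (a n * r)) \<le> weight n G"
proof -
  obtain i where i: "I x = ereal i"
    using r I_nonneg[of x] by (cases "I x") auto
  \<comment> \<open>One \<open>d\<close> each pays for the oscillation of \<open>g\<close>, the error in \<open>f_approx\<close> and the gap in
    \<open>LDP_lower\<close>.\<close>
  define d where "d = (r - i - g x) / 3"
  have d: "0 < d" using r i by (simp add: d_def)
  define G' where "G' = G \<inter> {y. g y < g x + d}"
  have G': "open G'" unfolding G'_def using G g_cont by (auto intro!: open_Int open_Collect_less)
  have "x \<in> G'" using x d by (simp add: G'_def)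
  have "\<forall>\<^sub>F n in sequentially. exp (- (a n * (i + d))) \<le> measure (P n) {\<omega> \<in> space (P n). Y n \<omega> \<in> G'}"
    by (rule LDP_lower[OF P_LDP a_pos G' \<open>x \<in> G'\<close>]) (use i d in simp)
  moreover have "\<forall>\<^sub>F n in sequentially. \<forall>\<omega>\<in>space (P n). \<bar>f n \<omega> - g (Y n \<omega>)\<bar> \<le> d"
    by (rule f_approx[OF d])
  ultimately show ?thesis
  proof eventually_elim
    case (elim n)
    have "exp (- (a n * r)) = exp (- (a n * (g x + 2 * d))) * exp (- (a n * (i + d)))"
      by (simp add: d_def field_simps flip: exp_add)
    also have "\<dots> \<le> exp (- (a n * (g x + 2 * d))) * measure (P n) {\<omega> \<in> space (P n). Y n \<omega> \<in> G'}"
      using elim(1) by (intro mult_left_mono) auto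
    also have "\<dots> \<le> weight n G'"
      using elim(2) by (intro weight_ge borel_open G') (force simp: G'_def)
    also have "\<dots> \<le> weight n G"
      by (intro weight_mono borel_open G G') (auto simp: G'_def)
    finally show ?case .
  qed
qed

text \<open>The infimum is finite: it is bounded below with \<open>g\<close>, and if it were \<open>\<infinity>\<close> then \<open>I\<close> would be
  identically \<open>\<infinity>\<close> and the whole space would have vanishing probability.\<close>
lemma INF_energy: "(INF x. I x + ereal (g x)) = ereal min_energy"
proof -
  obtain B where B: "\<And>x. \<bar>g x\<bar> \<le> B" using g_bdd by (auto simp: bounded_iff)
  have "ereal (- B) \<le> (INF x. I x + ereal (g x))"
  proof (rule INF_greatest)
    fix x
    have "ereal 0 + ereal (- B) \<le> I x + ereal (g x)"
      using I_nonneg[of x] B[of x] by (intro add_mono) (auto simp: zero_ereal_def)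
    then show "ereal (- B) \<le> I x + ereal (g x)" by simp
  qed
  moreover have "(INF x. I x + ereal (g x)) \<noteq> \<infinity>"
  proof
    assume "(INF x. I x + ereal (g x)) = \<infinity>"
    then have "I x + ereal (g x) = \<infinity>" for x
      by (metis INF_lower UNIV_I ereal_infty_less_eq(1))
    then have "I x = \<infinity>" for x by (metis ereal_plus_eq_PInfty MInfty_neq_PInfty(1) PInfty_neq_ereal(2))
    then have "\<forall>\<^sub>F n in sequentially. measure (P n) {\<omega> \<in> space (P n). Y n \<omega> \<in> UNIV} \<le> exp (- (a n * 1))"
      by (intro LDP_upper[OF P_LDP a_pos, of _ 2]) auto
    then obtain n where "measure (P n) (space (P n)) \<le> exp (- a n)"
      by (auto simp: eventually_sequentially)
    moreover have "exp (- a n) < 1" using a_pos[of n] by simp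
    ultimately show False using prob_space.prob_space[OF P_prob, of n] by simp
  qed
  ultimately show ?thesis
    unfolding min_energy_def by (cases "INF x. I x + ereal (g x)") auto
qed

lemma min_energy_le: "ereal min_energy \<le> I x + ereal (g x)"
  unfolding INF_energy[symmetric] by (rule INF_lower) simp

lemma weight_UNIV_pos: "0 < weight n UNIV"
proof -
  interpret prob_space "P n" by (rule P_prob)
  obtain B where B: "\<And>\<omega>. \<omega> \<in> space (P n) \<Longrightarrow> \<bar>f n \<omega>\<bar> \<le> B"
    using f_bdd[of n] by (auto simp: bounded_iff)
  have "exp (- (a n * B)) * measure (P n) {\<omega> \<in> space (P n). Y n \<omega> \<in> UNIV} \<le> weight n UNIV"
    by (rule weight_ge) (use B in force)+
  then show ?thesis by (simp add: prob_space) (meson exp_gt_zero less_le_trans)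
qed

lemma weight_UNIV_upper:
  assumes "r < min_energy"
  shows "\<forall>\<^sub>F n in sequentially. weight n UNIV \<le> exp (- (a n * r))"
  using assms by (intro weight_upper[of _ min_energy] min_energy_le) auto

lemma weight_UNIV_lower:
  assumes "min_energy < r"
  shows "\<forall>\<^sub>F n in sequentially. exp (- (a n * r)) \<le> weight n UNIV"
proof -
  have "(INF x. I x + ereal (g x)) < ereal r" using assms by (simp add: INF_energy)
  then obtain x where "I x + ereal (g x) < ereal r" by (auto simp: INF_less_iff)
  then show ?thesis by (intro weight_lower) auto
qed

lemma log_weight_lim: "(\<lambda>n. 1 / a n * ln (weight n UNIV)) \<longlonglongrightarrow> - min_energy"
proof (rule tendstoI)
  fix e :: real assume e: "0 < e"
  have "\<forall>\<^sub>F n in sequentially. weight n UNIV \<le> exp (- (a n * (min_energy - e / 2)))"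
    by (rule weight_UNIV_upper) (use e in simp)
  moreover have "\<forall>\<^sub>F n in sequentially. exp (- (a n * (min_energy + e / 2))) \<le> weight n UNIV"
    by (rule weight_UNIV_lower) (use e in simp)
  ultimately show "\<forall>\<^sub>F n in sequentially. dist (1 / a n * ln (weight n UNIV)) (- min_energy) < e"
  proof eventually_elim
    case (elim n)
    have "ln (weight n UNIV) \<le> - (a n * (min_energy - e / 2))"
      using elim(1) weight_UNIV_pos[of n] by (metis ln_exp ln_le_cancel_iff exp_gt_zero)
    moreover have "- (a n * (min_energy + e / 2)) \<le> ln (weight n UNIV)"
      using elim(2) weight_UNIV_pos[of n] by (metis ln_exp ln_le_cancel_iff exp_gt_zero)
    ultimately have "1 / a n * ln (weight n UNIV) \<le> - (min_energy - e / 2)"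
        "- (min_energy + e / 2) \<le> 1 / a n * ln (weight n UNIV)"
      using a_pos[of n] by (simp_all add: field_simps)
    then show ?case using e by (simp add: dist_real_def abs_less_iff)
  qed
qed

lemma space_tilted [simp]: "space (tilted n) = space (P n)"
  by (simp add: tilted_def)

lemma measure_tilted:
  assumes A [measurable]: "A \<in> sets borel"
  shows "measure (tilted n) {\<omega> \<in> space (P n). Y n \<omega> \<in> A} = weight n A / weight n UNIV"
proof -
  let ?E = "{\<omega> \<in> space (P n). Y n \<omega> \<in> A}"
  let ?h = "\<lambda>\<omega>. 1 / weight n UNIV * exp (- (a n * f n \<omega>))"
  have nonneg: "0 \<le> ?h \<omega>" for \<omega> using weight_UNIV_pos[of n] by simp
  have "measure (tilted n) ?E = (\<integral>\<omega>. indicator ?E \<omega> \<partial>tilted n)"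
    by (subst Bochner_Integration.integral_indicator)
      (auto simp: tilted_def intro!: arg_cong2[where f=measure])
  also have "\<dots> = (\<integral>\<omega>. ?h \<omega> *\<^sub>R indicator ?E \<omega> \<partial>P n)"
    unfolding tilted_def by (rule integral_density) (use nonneg in auto)
  also have "\<dots> = (\<integral>\<omega>. 1 / weight n UNIV * (indicator A (Y n \<omega>) * exp (- (a n * f n \<omega>))) \<partial>P n)"
    by (rule Bochner_Integration.integral_cong) (auto simp: indicator_def)
  also have "\<dots> = weight n A / weight n UNIV"
    unfolding weight_def[of n A] by (subst integral_mult_right_zero) simp
  finally show ?thesis .
qed

lemma prob_space_tilted: "prob_space (tilted n)"
proof (rule prob_spaceI)
  have "measure (tilted n) (space (tilted n)) = 1"
    using measure_tilted[of UNIV n] weight_UNIV_pos[of n] by simp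
  then show "emeasure (tilted n) (space (tilted n)) = 1"
    by (metis ennreal_1 enn2real_eq_0_iff measure_def enn2real_0 ennreal_enn2real less_top zero_neq_one enn2real_top)
qed

lemma tilted_rate_nonneg: "0 \<le> I x + ereal (g x) - ereal min_energy"
  using min_energy_le[of x] by (cases "I x") auto

lemma rate_function_tilted: "rate_function (\<lambda>x. I x + ereal (g x) - ereal min_energy)"
proof -
  obtain B where "\<And>x. \<bar>g x\<bar> \<le> B" using g_bdd by (auto simp: bounded_iff)
  then have "- B \<le> g x" for x by (metis abs_le_iff minus_le_iff)
  then show ?thesis by (rule rate_function_tilt[OF I_rate g_cont _ tilted_rate_nonneg])
qed

text \<open>The tilted probability of an event is its weight divided by the total weight, and the total
  weight is \<open>exp (- (a n * min_energy))\<close> up to subexponential factors, which shifts the rate by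
  \<open>min_energy\<close>.\<close>
lemma LDP_tilted: "LDP tilted Y a (\<lambda>x. I x + ereal (g x) - ereal min_energy)"
proof (rule LDP_I[OF a_pos prob_space_tilted rate_function_tilted])
  fix F c and r :: real
  assume F: "closed F" and c: "\<And>x. x \<in> F \<Longrightarrow> ereal c \<le> I x + ereal (g x) - ereal min_energy" and r: "r < c"
  define d where "d = (c - r) / 2"
  have d: "0 < d" using r by (simp add: d_def)
  have "\<forall>\<^sub>F n in sequentially. weight n F \<le> exp (- (a n * (r + d + min_energy)))"
  proof (rule weight_upper[OF F, of "c + min_energy"])
    show "ereal (c + min_energy) \<le> I x + ereal (g x)" if "x \<in> F" for x
      using c[OF that] by (cases "I x") auto
  qed (use r in \<open>simp add: d_def field_simps\<close>)
  moreover have "\<forall>\<^sub>F n in sequentially. exp (- (a n * (min_energy + d))) \<le> weight n UNIV"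
    by (rule weight_UNIV_lower) (use d in simp)
  ultimately show "\<forall>\<^sub>F n in sequentially.
      measure (tilted n) {\<omega> \<in> space (tilted n). Y n \<omega> \<in> F} \<le> exp (- (a n * r))"
  proof eventually_elim
    case (elim n)
    have "weight n F / weight n UNIV
        \<le> exp (- (a n * (r + d + min_energy))) / exp (- (a n * (min_energy + d)))"
      using elim by (intro frac_le) auto
    also have "\<dots> = exp (- (a n * r))" by (simp add: algebra_simps flip: exp_diff)
    finally show ?case using F by (simp add: measure_tilted)
  qed
next
  fix G x and r :: real
  assume G: "open G" and x: "x \<in> G" and r: "I x + ereal (g x) - ereal min_energy < ereal r"
  obtain i where i: "I x = ereal i"
    using r I_nonneg[of x] by (cases "I x") auto
  define d where "d = (r - (i + g x - min_energy)) / 2"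
  have d: "0 < d" using r i by (simp add: d_def)
  have "\<forall>\<^sub>F n in sequentially. exp (- (a n * (r - d + min_energy))) \<le> weight n G"
  proof (rule weight_lower[OF G x])
    show "I x + ereal (g x) < ereal (r - d + min_energy)"
      using d i by (simp add: d_def field_simps)
  qed
  moreover have "\<forall>\<^sub>F n in sequentially. weight n UNIV \<le> exp (- (a n * (min_energy - d)))"
    by (rule weight_UNIV_upper) (use d in simp)
  ultimately show "\<forall>\<^sub>F n in sequentially.
      exp (- (a n * r)) \<le> measure (tilted n) {\<omega> \<in> space (tilted n). Y n \<omega> \<in> G}"
  proof eventually_elim
    case (elim n)
    have "exp (- (a n * r)) = exp (- (a n * (r - d + min_energy))) / exp (- (a n * (min_energy - d)))"
      by (simp add: algebra_simps flip: exp_diff)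
    also have "\<dots> \<le> weight n G / weight n UNIV"
      using elim weight_UNIV_pos[of n] by (intro frac_le) (auto intro: less_imp_le[OF less_le_trans[OF exp_gt_zero]])
    finally show ?case using G by (simp add: measure_tilted)
  qed
qed

end

section \<open>The zero set of a rate function governs the probabilities\<close>

lemma rate_function_zero_set:
  fixes K :: "'x::t2_space \<Rightarrow> ereal"
  assumes K: "rate_function K" and "(INF x. K x) = 0"
  shows "{x. K x = 0} \<noteq> {}" "compact {x. K x = 0}"
proof -
  show "{x. K x = 0} \<noteq> {}"
    using rate_function_attains_INF[OF K closed_UNIV, of 0] assms(2) by (auto simp: zero_ereal_def)
  have "{x. K x = 0} = {x. K x \<le> ereal 0}"
    using K by (auto simp: rate_function_def zero_ereal_def intro: antisym)
  then show "compact {x. K x = 0}" using K by (simp add: rate_function_def)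
qed

lemma rate_function_INF_pos:
  fixes K :: "'x::t2_space \<Rightarrow> ereal"
  assumes K: "rate_function K" and F: "closed F" and "F \<inter> {x. K x = 0} = {}"
  shows "0 < (INF x\<in>F. K x)"
proof -
  have "0 \<le> (INF x\<in>F. K x)" using K by (auto simp: rate_function_def intro: INF_greatest)
  moreover have "(INF x\<in>F. K x) \<noteq> 0"
    using rate_function_attains_INF[OF K F, of 0] assms(3) by (auto simp: zero_ereal_def)
  ultimately show ?thesis by simp
qed

text \<open>The finitely many initial indices, at which the large deviation bound may fail, are absorbed
  into the constant.\<close>
lemma eventually_exp_bound_imp_bound:
  fixes p a :: "nat \<Rightarrow> real"
  assumes ev: "\<forall>\<^sub>F n in sequentially. p n \<le> exp (- (a n * s))" and p: "\<And>n. p n \<le> 1"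
  shows "\<exists>C. \<forall>n. p n \<le> C * exp (- (a n * s))"
proof -
  obtain N where N: "\<And>n. N \<le> n \<Longrightarrow> p n \<le> exp (- (a n * s))"
    using ev unfolding eventually_sequentially by blast
  define C where "C = 1 + (\<Sum>n<N. exp (a n * s))"
  have "p n \<le> C * exp (- (a n * s))" for n
  proof (cases "N \<le> n")
    case True
    have "1 \<le> C" by (simp add: C_def sum_nonneg)
    then have "1 * exp (- (a n * s)) \<le> C * exp (- (a n * s))" by (intro mult_right_mono) auto
    then show ?thesis using N[OF True] by linarith
  next
    case False
    then have "exp (a n * s) \<le> (\<Sum>n<N. exp (a n * s))" by (intro member_le_sum) auto
    then have "exp (a n * s) * exp (- (a n * s)) \<le> C * exp (- (a n * s))"
      by (intro mult_right_mono) (auto simp: C_def)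
    then show ?thesis using p[of n] by (simp flip: exp_add)
  qed
  then show ?thesis by blast
qed

lemma exp_decay:
  fixes a :: "nat \<Rightarrow> real"
  assumes "filterlim a at_top sequentially" "0 < s"
  shows "(\<lambda>n. C * exp (- (a n * s))) \<longlonglongrightarrow> 0"
proof -
  have "filterlim (\<lambda>n. a n * s) at_top sequentially"
    by (subst mult.commute) (rule filterlim_tendsto_pos_mult_at_top[OF tendsto_const assms(2,1)])
  then have "(\<lambda>n. exp (- (a n * s))) \<longlonglongrightarrow> 0"
    by (intro filterlim_compose[OF exp_at_bot]) (simp add: filterlim_uminus_at_bot)
  then show ?thesis by (rule tendsto_mult_right_zero)
qed

text \<open>Any exponent strictly below the infimum \<open>J\<close> of the rate over the closure is achieved, for instance
  \<open>J / 2\<close> when \<open>0 < J < \<infinity>\<close>.\<close>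
lemma LDP_exponential_bound:
  fixes Y :: "nat \<Rightarrow> 'w \<Rightarrow> 'x::topological_space"
  assumes L: "LDP Q Y a K" and a: "\<And>n. 0 < a n" and Y: "\<And>n. Y n \<in> borel_measurable (Q n)"
    and s: "ereal s < (INF x\<in>closure A. K x)"
  shows "\<exists>C. \<forall>n. measure (Q n) {\<omega> \<in> space (Q n). Y n \<omega> \<in> A} \<le> C * exp (- (a n * s))"
proof (rule eventually_exp_bound_imp_bound)
  have prob: "prob_space (Q n)" for n using L by (simp add: LDP_def)
  show "measure (Q n) {\<omega> \<in> space (Q n). Y n \<omega> \<in> A} \<le> 1" for n
    by (rule prob_space.prob_le_1[OF prob])
  obtain c where c: "ereal s < ereal c" "ereal c < (INF x\<in>closure A. K x)"
    using s ereal_dense2 by blast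
  have "\<forall>\<^sub>F n in sequentially. measure (Q n) {\<omega> \<in> space (Q n). Y n \<omega> \<in> closure A} \<le> exp (- (a n * s))"
  proof (rule LDP_upper[OF L a closed_closure])
    show "ereal c \<le> K x" if "x \<in> closure A" for x
      using c(2) that by (meson INF_lower less_imp_le less_le_trans)
  qed (use c in simp)
  then show "\<forall>\<^sub>F n in sequentially. measure (Q n) {\<omega> \<in> space (Q n). Y n \<omega> \<in> A} \<le> exp (- (a n * s))"
  proof eventually_elim
    case (elim n)
    interpret prob_space "Q n" by (rule prob)
    have [measurable]: "Y n \<in> borel_measurable (Q n)" by (rule Y)
    have "measure (Q n) {\<omega> \<in> space (Q n). Y n \<omega> \<in> A} \<le> measure (Q n) {\<omega> \<in> space (Q n). Y n \<omega> \<in> closure A}"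
    proof (rule finite_measure_mono)
      have "closure A \<in> sets borel" by simp
      then show "{\<omega> \<in> space (Q n). Y n \<omega> \<in> closure A} \<in> sets (Q n)" by measurable
    qed (use closure_subset[of A] in auto)
    then show ?case using elim by simp
  qed
qed

section \<open>The canonical ensemble\<close>

text \<open>The uniform approximation passes from the components of \<open>H n\<close> to their linear combination with
  coefficients \<open>\<beta>\<close>.\<close>
lemma inner_uniform_approx:
  fixes H :: "nat \<Rightarrow> 'w \<Rightarrow> real ^ 's" and h :: "nat \<Rightarrow> 'w \<Rightarrow> real ^ 's"
  assumes bdd: "\<And>n i. bounded ((\<lambda>\<omega>. H n \<omega> $ i - h n \<omega> $ i) ` S n)"
    and lim: "\<And>i. (\<lambda>n. SUP \<omega>\<in>S n. \<bar>H n \<omega> $ i - h n \<omega> $ i\<bar>) \<longlonglongrightarrow> 0"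
    and d: "0 < d"
  shows "\<forall>\<^sub>F n in sequentially. \<forall>\<omega>\<in>S n. \<bar>\<beta> \<bullet> H n \<omega> - \<beta> \<bullet> h n \<omega>\<bar> \<le> d"
proof -
  define s where "s n = (\<Sum>i\<in>UNIV. \<bar>\<beta> $ i\<bar> * (SUP \<omega>\<in>S n. \<bar>H n \<omega> $ i - h n \<omega> $ i\<bar>))" for n
  have "s \<longlonglongrightarrow> (\<Sum>i\<in>UNIV. \<bar>\<beta> $ i\<bar> * 0)"
    unfolding s_def by (intro tendsto_sum tendsto_mult tendsto_const lim)
  then have "\<forall>\<^sub>F n in sequentially. s n < d"
    using d by (intro order_tendstoD(2)) auto
  then show ?thesis
  proof eventually_elim
    case (elim n)
    have "\<bar>\<beta> \<bullet> H n \<omega> - \<beta> \<bullet> h n \<omega>\<bar> \<le> s n" if \<omega>: "\<omega> \<in> S n" for \<omega>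
    proof -
      have comp: "\<bar>H n \<omega> $ i - h n \<omega> $ i\<bar> \<le> (SUP \<omega>\<in>S n. \<bar>H n \<omega> $ i - h n \<omega> $ i\<bar>)" for i
      proof (rule cSUP_upper[OF \<omega>])
        show "bdd_above ((\<lambda>\<omega>. \<bar>H n \<omega> $ i - h n \<omega> $ i\<bar>) ` S n)"
          using bdd[of n i] by (auto simp: bounded_iff bdd_above_def)
      qed
      have "\<bar>\<beta> \<bullet> H n \<omega> - \<beta> \<bullet> h n \<omega>\<bar> = \<bar>\<Sum>i\<in>UNIV. \<beta> $ i * (H n \<omega> $ i - h n \<omega> $ i)\<bar>"
        by (simp add: inner_vec_def sum_subtractf right_diff_distrib)
      also have "\<dots> \<le> (\<Sum>i\<in>UNIV. \<bar>\<beta> $ i * (H n \<omega> $ i - h n \<omega> $ i)\<bar>)" by (rule sum_abs)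
      also have "\<dots> \<le> s n"
        unfolding s_def abs_mult by (intro sum_mono mult_left_mono comp) auto
      finally show ?thesis .
    qed
    then show ?case using elim by force
  qed
qed

lemma bounded_inner_vec:
  fixes v :: "'w \<Rightarrow> real ^ 's"
  assumes "\<And>i. bounded ((\<lambda>\<omega>. v \<omega> $ i) ` S)"
  shows "bounded ((\<lambda>\<omega>. \<beta> \<bullet> v \<omega>) ` S)"
proof -
  have "\<forall>i. \<exists>B. \<forall>\<omega>\<in>S. \<bar>v \<omega> $ i\<bar> \<le> B" using assms by (simp add: bounded_iff)
  then obtain B where B: "\<And>i \<omega>. \<omega> \<in> S \<Longrightarrow> \<bar>v \<omega> $ i\<bar> \<le> B i" by metis
  have "norm (\<beta> \<bullet> v \<omega>) \<le> (\<Sum>i\<in>UNIV. \<bar>\<beta> $ i\<bar> * B i)" if "\<omega> \<in> S" for \<omega>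
    unfolding inner_vec_def real_norm_def
    by (rule order_trans[OF sum_abs]) (auto simp: abs_mult intro!: sum_mono mult_left_mono B[OF that])
  then show ?thesis by (auto simp: bounded_iff)
qed

text \<open>An infimum of affine functions of \<open>\<beta>\<close> is concave; a finite one on a finite-dimensional space is
  then continuous.\<close>
lemma concave_INF_affine:
  fixes h :: "'x \<Rightarrow> 'b::real_inner" and I :: "'x \<Rightarrow> ereal"
  assumes \<phi>: "\<And>\<beta>. ereal (\<phi> \<beta>) = (INF x. I x + ereal (\<beta> \<bullet> h x))"
  shows "concave_on UNIV \<phi>"
  unfolding concave_on_iff
proof (intro conjI ballI allI impI)
  fix \<beta> \<gamma> :: 'b and u v :: real
  assume uv: "0 \<le> u" "0 \<le> v" "u + v = 1"
  have le: "ereal (\<phi> \<delta>) \<le> I x + ereal (\<delta> \<bullet> h x)" for \<delta> x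
    unfolding \<phi> by (rule INF_lower) simp
  have "ereal (u * \<phi> \<beta> + v * \<phi> \<gamma>) \<le> (INF x. I x + ereal ((u *\<^sub>R \<beta> + v *\<^sub>R \<gamma>) \<bullet> h x))"
  proof (rule INF_greatest)
    fix x
    show "ereal (u * \<phi> \<beta> + v * \<phi> \<gamma>) \<le> I x + ereal ((u *\<^sub>R \<beta> + v *\<^sub>R \<gamma>) \<bullet> h x)"
    proof (cases "I x")
      case (real i)
      have "u * \<phi> \<beta> + v * \<phi> \<gamma> \<le> u * (i + \<beta> \<bullet> h x) + v * (i + \<gamma> \<bullet> h x)"
        using le[of \<beta> x] le[of \<gamma> x] uv real by (intro add_mono mult_left_mono) auto
      also have "\<dots> = (u + v) * i + (u *\<^sub>R \<beta> + v *\<^sub>R \<gamma>) \<bullet> h x"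
        by (simp add: inner_add_left algebra_simps)
      finally show ?thesis using real uv by simp
    next
      case MInf
      then show ?thesis using le[of \<beta> x] by simp
    qed simp
  qed
  then show "u * \<phi> \<beta> + v * \<phi> \<gamma> \<le> \<phi> (u *\<^sub>R \<beta> + v *\<^sub>R \<gamma>)"
    unfolding \<phi>[symmetric] by simp
qed simp

lemma concave_on_UNIV_continuous:
  fixes \<phi> :: "'b::euclidean_space \<Rightarrow> real"
  assumes "concave_on UNIV \<phi>"
  shows "continuous_on UNIV \<phi>"
proof -
  have "continuous_on UNIV (\<lambda>\<beta>. - \<phi> \<beta>)"
    using assms by (intro convex_on_continuous) (auto simp: concave_on_def)
  then have "continuous_on UNIV (\<lambda>\<beta>. - (- \<phi> \<beta>))" by (rule continuous_on_minus)
  then show ?thesis by simp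
qed

theorem theorem2p4:
  fixes P :: "nat \<Rightarrow> 'w measure"
    and H :: "nat \<Rightarrow> 'w \<Rightarrow> real ^ 's"
    and a :: "nat \<Rightarrow> real"
    and Y :: "nat \<Rightarrow> 'w \<Rightarrow> 'x::polish_space"
    and Ht :: "'x \<Rightarrow> real ^ 's"
    and I :: "'x \<Rightarrow> ereal"
    and \<beta> :: "real ^ 's"
  assumes P_prob: "\<And>n. prob_space (P n)"
    and H_meas: "\<And>n i. (\<lambda>\<omega>. H n \<omega> $ i) \<in> borel_measurable (P n)"
    and H_bdd: "\<And>n i. bounded ((\<lambda>\<omega>. H n \<omega> $ i) ` space (P n))"
    and a_pos: "\<And>n. a n > 0"
    and a_lim: "filterlim a at_top sequentially"
    and Y_meas: "\<And>n. Y n \<in> borel_measurable (P n)"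
    and Ht_cont: "\<And>i. continuous_on UNIV (\<lambda>x. Ht x $ i)"
    and Ht_bdd: "\<And>i. bounded (range (\<lambda>x. Ht x $ i))"
    and H_approx: "\<And>i. (\<lambda>n. SUP \<omega>\<in>space (P n). \<bar>H n \<omega> $ i - Ht (Y n \<omega>) $ i\<bar>) \<longlonglongrightarrow> 0"
    and P_LDP: "LDP P Y a I"
  shows
    "(convergent (\<lambda>n. 1 / a n * ln (partition_fun P H n (a n *\<^sub>R \<beta>))) \<and>
      ereal (free_energy a P H \<beta>) = (INF x. ereal (\<beta> \<bullet> Ht x) + I x) \<and>
      concave_on UNIV (free_energy a P H) \<and>
      continuous_on UNIV (free_energy a P H))
     \<and>
     (LDP (\<lambda>n. canonical P H n (a n *\<^sub>R \<beta>)) Y a (canonical_rate I Ht \<beta>) \<and>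
      (\<forall>x. canonical_rate I Ht \<beta> x = I x + ereal (\<beta> \<bullet> Ht x) - ereal (free_energy a P H \<beta>)))
     \<and>
     (equilibrium_set I Ht \<beta> \<noteq> {} \<and>
      compact (equilibrium_set I Ht \<beta>) \<and>
      (\<forall>x. x \<in> equilibrium_set I Ht \<beta> \<longleftrightarrow>
         I x + ereal (\<beta> \<bullet> Ht x) = (INF y. I y + ereal (\<beta> \<bullet> Ht y)) \<and>
         (INF y. I y + ereal (\<beta> \<bullet> Ht y)) = ereal (free_energy a P H \<beta>)) \<and>
      (\<forall>x. x \<in> equilibrium_set I Ht \<beta> \<longleftrightarrow>
         (\<forall>y. I x + ereal (\<beta> \<bullet> Ht x) \<le> I y + ereal (\<beta> \<bullet> Ht y))))
     \<and>
     (\<forall>A \<in> sets borel. closure A \<inter> equilibrium_set I Ht \<beta> = {} \<longrightarrow>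
        (let p = (\<lambda>n. measure (canonical P H n (a n *\<^sub>R \<beta>)) {\<omega> \<in> space (P n). Y n \<omega> \<in> A});
             J = (INF x\<in>closure A. canonical_rate I Ht \<beta> x)
         in 0 < J \<and>
            (J < \<infinity> \<longrightarrow>
              (\<exists>C::real. (\<forall>n. p n \<le> C * exp (- a n * real_of_ereal J / 2)) \<and>
                 (\<lambda>n. C * exp (- a n * real_of_ereal J / 2)) \<longlonglongrightarrow> 0)) \<and>
            (J = \<infinity> \<longrightarrow>
              (\<forall>r::real. r > 0 \<longrightarrow>
                 (\<exists>C::real. (\<forall>n. p n \<le> C * exp (- a n * r / 2)) \<and>
                   (\<lambda>n. C * exp (- a n * r / 2)) \<longlonglongrightarrow> 0))) \<and>
            p \<longlonglongrightarrow> 0))"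
proof -
  have tilt: "exponential_tilt P (\<lambda>n \<omega>. \<gamma> \<bullet> H n \<omega>) a Y (\<lambda>x. \<gamma> \<bullet> Ht x) I" for \<gamma>
  proof (rule exponential_tilt.intro)
    show "(\<lambda>\<omega>. \<gamma> \<bullet> H n \<omega>) \<in> borel_measurable (P n)" for n
      unfolding inner_vec_def by (intro borel_measurable_sum borel_measurable_inner borel_measurable_const H_meas)
    show "bounded ((\<lambda>\<omega>. \<gamma> \<bullet> H n \<omega>) ` space (P n))" for n
      by (rule bounded_inner_vec[OF H_bdd])
    show "continuous_on UNIV (\<lambda>x. \<gamma> \<bullet> Ht x)"
      unfolding inner_vec_def by (intro continuous_intros Ht_cont)
    show "bounded (range (\<lambda>x. \<gamma> \<bullet> Ht x))"
      by (rule bounded_inner_vec[OF Ht_bdd])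
    show "\<forall>\<^sub>F n in sequentially. \<forall>\<omega>\<in>space (P n). \<bar>\<gamma> \<bullet> H n \<omega> - \<gamma> \<bullet> Ht (Y n \<omega>)\<bar> \<le> d" if "0 < d" for d
    proof (rule inner_uniform_approx[OF _ H_approx that])
      fix n i
      have "bounded ((\<lambda>\<omega>. Ht (Y n \<omega>) $ i) ` space (P n))"
        by (rule bounded_subset[OF Ht_bdd]) auto
      then show "bounded ((\<lambda>\<omega>. H n \<omega> $ i - Ht (Y n \<omega>) $ i) ` space (P n))"
        by (rule bounded_minus_comp[OF H_bdd])
    qed
  qed (rule P_prob a_pos a_lim Y_meas P_LDP)+

  define \<phi> where "\<phi> \<gamma> = exponential_tilt.min_energy (\<lambda>x. \<gamma> \<bullet> Ht x) I" for \<gamma>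
  have Z: "partition_fun P H n (a n *\<^sub>R \<gamma>) = exponential_tilt.weight P (\<lambda>n \<omega>. \<gamma> \<bullet> H n \<omega>) a Y n UNIV" for n \<gamma>
    unfolding partition_fun_def exponential_tilt.weight_def[OF tilt] by simp
  have Q: "canonical P H n (a n *\<^sub>R \<gamma>) = exponential_tilt.tilted P (\<lambda>n \<omega>. \<gamma> \<bullet> H n \<omega>) a Y n" for n \<gamma>
    unfolding canonical_def exponential_tilt.tilted_def[OF tilt] Z by simp
  have lim: "(\<lambda>n. 1 / a n * ln (partition_fun P H n (a n *\<^sub>R \<gamma>))) \<longlonglongrightarrow> - \<phi> \<gamma>" for \<gamma>
    unfolding Z \<phi>_def by (rule exponential_tilt.log_weight_lim[OF tilt])
  have free: "free_energy a P H = \<phi>"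
    using limI[OF lim] by (simp add: free_energy_def fun_eq_iff)
  have INF: "(INF x. I x + ereal (\<gamma> \<bullet> Ht x)) = ereal (\<phi> \<gamma>)" for \<gamma>
    unfolding \<phi>_def by (rule exponential_tilt.INF_energy[OF tilt])
  have conc: "concave_on UNIV \<phi>" by (rule concave_INF_affine[OF INF[symmetric]])

  have K: "canonical_rate I Ht \<beta> = (\<lambda>x. I x + ereal (\<beta> \<bullet> Ht x) - ereal (\<phi> \<beta>))"
    by (simp add: fun_eq_iff canonical_rate_def INF)
  have L: "LDP (\<lambda>n. canonical P H n (a n *\<^sub>R \<beta>)) Y a (canonical_rate I Ht \<beta>)"
    unfolding K Q \<phi>_def by (rule exponential_tilt.LDP_tilted[OF tilt])
  then have rate: "rate_function (canonical_rate I Ht \<beta>)" by (simp add: LDP_def)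
  have zero_iff: "x \<in> equilibrium_set I Ht \<beta> \<longleftrightarrow> I x + ereal (\<beta> \<bullet> Ht x) = ereal (\<phi> \<beta>)" for x
    unfolding equilibrium_set_def K by (cases "I x") auto
  have \<phi>_le: "ereal (\<phi> \<beta>) \<le> I x + ereal (\<beta> \<bullet> Ht x)" for x
    unfolding INF[symmetric] by (rule INF_lower) simp
  have "(INF x. canonical_rate I Ht \<beta> x) = 0"
  proof (rule antisym)
    show "(INF x. canonical_rate I Ht \<beta> x) \<le> 0"
    proof (rule ereal_le_epsilon2)
      fix e :: real assume "0 < e"
      then have "(INF x. I x + ereal (\<beta> \<bullet> Ht x)) < ereal (\<phi> \<beta> + e)" by (simp add: INF)
      then obtain x where "I x + ereal (\<beta> \<bullet> Ht x) < ereal (\<phi> \<beta> + e)" by (auto simp: INF_less_iff)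
      then have "canonical_rate I Ht \<beta> x \<le> ereal e" unfolding K by (cases "I x") auto
      then show "(INF x. canonical_rate I Ht \<beta> x) \<le> 0 + ereal e"
        by (simp add: INF_lower2[of x])
    qed
    show "0 \<le> (INF x. canonical_rate I Ht \<beta> x)"
      using rate by (auto simp: rate_function_def intro: INF_greatest)
  qed
  note zero_set = rate_function_zero_set[OF rate this, folded equilibrium_set_def]

  have minimizer_iff: "x \<in> equilibrium_set I Ht \<beta> \<longleftrightarrow>
      (\<forall>y. I x + ereal (\<beta> \<bullet> Ht x) \<le> I y + ereal (\<beta> \<bullet> Ht y))" for x
  proof
    assume "x \<in> equilibrium_set I Ht \<beta>"
    then show "\<forall>y. I x + ereal (\<beta> \<bullet> Ht x) \<le> I y + ereal (\<beta> \<bullet> Ht y)"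
      using \<phi>_le by (simp add: zero_iff)
  next
    assume "\<forall>y. I x + ereal (\<beta> \<bullet> Ht x) \<le> I y + ereal (\<beta> \<bullet> Ht y)"
    then have "I x + ereal (\<beta> \<bullet> Ht x) \<le> ereal (\<phi> \<beta>)"
      unfolding INF[symmetric] by (intro INF_greatest) blast
    then show "x \<in> equilibrium_set I Ht \<beta>" using \<phi>_le[of x] by (simp add: zero_iff)
  qed

  have Y_can: "Y n \<in> borel_measurable (canonical P H n (a n *\<^sub>R \<beta>))" for n
    using Y_meas[of n] by (simp add: canonical_def)
  have space_can: "space (canonical P H n (a n *\<^sub>R \<beta>)) = space (P n)" for n
    by (simp add: canonical_def)
  have decay: "0 < (INF x\<in>closure A. canonical_rate I Ht \<beta> x) \<and>
      (\<forall>r. 0 < r \<longrightarrow> ereal (r / 2) < (INF x\<in>closure A. canonical_rate I Ht \<beta> x) \<longrightarrow>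
        (\<exists>C. (\<forall>n. measure (canonical P H n (a n *\<^sub>R \<beta>)) {\<omega> \<in> space (P n). Y n \<omega> \<in> A}
            \<le> C * exp (- a n * r / 2)) \<and> (\<lambda>n. C * exp (- a n * r / 2)) \<longlonglongrightarrow> 0)) \<and>
      (\<lambda>n. measure (canonical P H n (a n *\<^sub>R \<beta>)) {\<omega> \<in> space (P n). Y n \<omega> \<in> A}) \<longlonglongrightarrow> 0"
    (is "0 < ?J \<and> ?B \<and> ?p \<longlonglongrightarrow> 0")
    if A: "closure A \<inter> equilibrium_set I Ht \<beta> = {}" for A
  proof -
    have J: "0 < ?J"
      by (rule rate_function_INF_pos[OF rate closed_closure A[unfolded equilibrium_set_def]])
    have B: "\<exists>C. (\<forall>n. ?p n \<le> C * exp (- a n * r / 2)) \<and> (\<lambda>n. C * exp (- a n * r / 2)) \<longlonglongrightarrow> 0"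
      if r: "0 < r" "ereal (r / 2) < ?J" for r
      using LDP_exponential_bound[OF L a_pos Y_can r(2)] exp_decay[OF a_lim, of "r / 2"] r(1)
      by (simp add: space_can)
    obtain s where s: "0 < ereal s" "ereal s < ?J" using J ereal_dense2 by blast
    then obtain C where C: "\<And>n. ?p n \<le> C * exp (- a n * (2 * s) / 2)"
        "(\<lambda>n. C * exp (- a n * (2 * s) / 2)) \<longlonglongrightarrow> 0"
      using B[of "2 * s"] by auto
    have "?p \<longlonglongrightarrow> 0"
      by (rule tendsto_sandwich[OF _ _ tendsto_const C(2)]) (use C(1) in auto)
    then show ?thesis using J B by blast
  qed

  show ?thesis
  proof (intro conjI)
    show "convergent (\<lambda>n. 1 / a n * ln (partition_fun P H n (a n *\<^sub>R \<beta>)))"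
      using lim convergentI by blast
    show "ereal (free_energy a P H \<beta>) = (INF x. ereal (\<beta> \<bullet> Ht x) + I x)"
      unfolding free INF[symmetric] by (simp add: add.commute)
    show "concave_on UNIV (free_energy a P H)" unfolding free by (rule conc)
    show "continuous_on UNIV (free_energy a P H)"
      unfolding free by (rule concave_on_UNIV_continuous[OF conc])
    show "\<forall>x. canonical_rate I Ht \<beta> x = I x + ereal (\<beta> \<bullet> Ht x) - ereal (free_energy a P H \<beta>)"
      by (simp add: K free)
    show "\<forall>x. x \<in> equilibrium_set I Ht \<beta> \<longleftrightarrow>
         I x + ereal (\<beta> \<bullet> Ht x) = (INF y. I y + ereal (\<beta> \<bullet> Ht y)) \<and>
         (INF y. I y + ereal (\<beta> \<bullet> Ht y)) = ereal (free_energy a P H \<beta>)"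
      by (simp add: zero_iff INF free)
    show "\<forall>A \<in> sets borel. closure A \<inter> equilibrium_set I Ht \<beta> = {} \<longrightarrow>
        (let p = (\<lambda>n. measure (canonical P H n (a n *\<^sub>R \<beta>)) {\<omega> \<in> space (P n). Y n \<omega> \<in> A});
             J = (INF x\<in>closure A. canonical_rate I Ht \<beta> x)
         in 0 < J \<and>
            (J < \<infinity> \<longrightarrow>
              (\<exists>C::real. (\<forall>n. p n \<le> C * exp (- a n * real_of_ereal J / 2)) \<and>
                 (\<lambda>n. C * exp (- a n * real_of_ereal J / 2)) \<longlonglongrightarrow> 0)) \<and>
            (J = \<infinity> \<longrightarrow>
              (\<forall>r::real. r > 0 \<longrightarrow>
                 (\<exists>C::real. (\<forall>n. p n \<le> C * exp (- a n * r / 2)) \<and>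
                   (\<lambda>n. C * exp (- a n * r / 2)) \<longlonglongrightarrow> 0))) \<and>
            p \<longlonglongrightarrow> 0)"
      unfolding Let_def
    proof (intro ballI impI)
      fix A :: "'x set" assume "closure A \<inter> equilibrium_set I Ht \<beta> = {}"
      note dec = decay[OF this]
      let ?J = "INF x\<in>closure A. canonical_rate I Ht \<beta> x"
      have half: "0 < real_of_ereal ?J \<and> ereal (real_of_ereal ?J / 2) < ?J" if "?J < \<infinity>"
        using dec that by (cases ?J) auto
      show "0 < ?J \<and>
          (?J < \<infinity> \<longrightarrow> (\<exists>C. (\<forall>n. measure (canonical P H n (a n *\<^sub>R \<beta>)) {\<omega> \<in> space (P n). Y n \<omega> \<in> A}
              \<le> C * exp (- a n * real_of_ereal ?J / 2)) \<and>
            (\<lambda>n. C * exp (- a n * real_of_ereal ?J / 2)) \<longlonglongrightarrow> 0)) \<and>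
          (?J = \<infinity> \<longrightarrow> (\<forall>r. 0 < r \<longrightarrow>
            (\<exists>C. (\<forall>n. measure (canonical P H n (a n *\<^sub>R \<beta>)) {\<omega> \<in> space (P n). Y n \<omega> \<in> A}
              \<le> C * exp (- a n * r / 2)) \<and> (\<lambda>n. C * exp (- a n * r / 2)) \<longlonglongrightarrow> 0))) \<and>
          (\<lambda>n. measure (canonical P H n (a n *\<^sub>R \<beta>)) {\<omega> \<in> space (P n). Y n \<omega> \<in> A}) \<longlonglongrightarrow> 0"
      proof (intro conjI impI allI)
        show "0 < ?J" using dec by blast
      next
        assume "?J < \<infinity>"
        then show "\<exists>C. (\<forall>n. measure (canonical P H n (a n *\<^sub>R \<beta>)) {\<omega> \<in> space (P n). Y n \<omega> \<in> A}
              \<le> C * exp (- a n * real_of_ereal ?J / 2)) \<and>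
            (\<lambda>n. C * exp (- a n * real_of_ereal ?J / 2)) \<longlonglongrightarrow> 0"
          using dec half by blast
      next
        fix r :: real assume "?J = \<infinity>" "0 < r"
        then have "ereal (r / 2) < ?J" by simp
        then show "\<exists>C. (\<forall>n. measure (canonical P H n (a n *\<^sub>R \<beta>)) {\<omega> \<in> space (P n). Y n \<omega> \<in> A}
              \<le> C * exp (- a n * r / 2)) \<and> (\<lambda>n. C * exp (- a n * r / 2)) \<longlonglongrightarrow> 0"
          using dec \<open>0 < r\<close> by blast
      next
        show "(\<lambda>n. measure (canonical P H n (a n *\<^sub>R \<beta>)) {\<omega> \<in> space (P n). Y n \<omega> \<in> A}) \<longlonglongrightarrow> 0"
          using dec by blast
      qed
    qed
  qed (use L zero_set minimizer_iff in blast)+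
qed

end
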